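(* Let $A, B_2, C_2$ be real matrices of compatible sizes with $(A,B_2)$ stabilizable and $(A,C_2)$ detectable, let $\mathbf{P}_{22}=C_2(zI-A)^{-1}B_2$ (strictly proper), and let $\mathbf{U}_r,\mathbf{V}_r,\mathbf{U}_l,\mathbf{V}_l,\mathbf{M}_r,\mathbf{M}_l,\mathbf{N}_r,\mathbf{N}_l$ be any doubly-coprime factorization of $\mathbf{P}_{22}$. Let $g$ be a (real-valued) functional of quadruples of transfer matrices $(\mathbf{R},\mathbf{M},\mathbf{N},\mathbf{L})$ and let $\mathcal{S}$ be a set of transfer matrices (a system-level constraint). Consider the system-level synthesis (SLS) problem $$\min_{\mathbf{R},\mathbf{M},\mathbf{N},\mathbf{L}}\ g(\mathbf{R},\mathbf{M},\mathbf{N},\mathbf{L})\quad\text{subject to the SLP constraints and}\quad \begin{bmatrix}\mathbf{R}&\mathbf{N}\\ \mathbf{M}&\mathbf{L}\end{bmatrix}\in\mathcal{S}.\qquad(\mathrm{SLS})$$ The following statements hold. (1) (SLS) is equivalent to the following problem in the Youla parameter $\mathbf{Q}$: $$\min_{\mathbf{Q}\in\mathcal{RH}_\infty}\ g_1(\mathbf{Q})\quad\text{subject to}\quad \begin{bmatrix}f_1(\mathbf{Q})&f_3(\mathbf{Q})\\ f_2(\mathbf{Q})&f_4(\mathbf{Q})\end{bmatrix}\in\mathcal{S},\qquad(\mathrm{Y})$$ where $f_1(\mathbf{Q})=(zI-A)^{-1}+(zI-A)^{-1}B_2(\mathbf{V}_r-\mathbf{M}_r\mathbf{Q})\mathbf{M}_lC_2(zI-A)^{-1}$,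 $f_2(\mathbf{Q})=(\mathbf{V}_r-\mathbf{M}_r\mathbf{Q})\mathbf{M}_lC_2(zI-A)^{-1}$, $f_3(\mathbf{Q})=(zI-A)^{-1}B_2(\mathbf{V}_r-\mathbf{M}_r\mathbf{Q})\mathbf{M}_l$, $f_4(\mathbf{Q})=(\mathbf{V}_r-\mathbf{M}_r\mathbf{Q})\mathbf{M}_l$, and $g_1(\mathbf{Q}):=g(f_1(\mathbf{Q}),f_2(\mathbf{Q}),f_3(\mathbf{Q}),f_4(\mathbf{Q}))$. (2) (SLS) is equivalent to the following problem in the input-output parameters $\mathbf{Y},\mathbf{U},\mathbf{W},\mathbf{Z}$: $$\min_{\mathbf{Y},\mathbf{U},\mathbf{W},\mathbf{Z}}\ \hat g_1(\mathbf{U})\quad\text{subject to the IOP constraints and}\quad \begin{bmatrix}\hat f_1(\mathbf{U})&\hat f_3(\mathbf{U})\\ \hat f_2(\mathbf{U})&\hat f_4(\mathbf{U})\end{bmatrix}\in\mathcal{S},\qquad(\mathrm{IO})$$ where $\hat f_1(\mathbf{U})=(zI-A)^{-1}+(zI-A)^{-1}B_2\mathbf{U}C_2(zI-A)^{-1}$, $\hat f_2(\mathbf{U})=\mathbf{U}C_2(zI-A)^{-1}$, $\hat f_3(\mathbf{U})=(zI-A)^{-1}B_2\mathbf{U}$, $\hat f_4(\mathbf{U})=\mathbf{U}$, and $\hat g_1(\mathbf{U}):=g(\hat f_1(\mathbf{U}),\hat f_2(\mathbf{U}),\hat f_3(\mathbf{U}),\hat f_4(\mathbf{U}))$. (3)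 If (SLS) is convex (i.e. $g$ is a convex functional and $\mathcal{S}$ is a convex set), then the problems (Y) and (IO) are both convex.
   Context: Discrete-time setting: transfer matrices are matrices of real-rational functions of $z$. $\mathcal{RH}_\infty$ denotes the set of real-rational, proper, stable transfer matrices (all poles in the open unit disk), of whatever size is required; $\tfrac1z\mathcal{RH}_\infty$ denotes the stable and strictly proper ones. Stabilizability and detectability are meant in the discrete-time sense. Doubly-coprime factorization of $\mathbf{P}_{22}$: a collection $\mathbf{U}_l,\mathbf{V}_l,\mathbf{N}_l,\mathbf{M}_l,\mathbf{U}_r,\mathbf{V}_r,\mathbf{N}_r,\mathbf{M}_r\in\mathcal{RH}_\infty$ such that $\mathbf{P}_{22}=\mathbf{N}_r\mathbf{M}_r^{-1}=\mathbf{M}_l^{-1}\mathbf{N}_l$ and $$\begin{bmatrix}\mathbf{U}_l&-\mathbf{V}_l\\ -\mathbf{N}_l&\mathbf{M}_l\end{bmatrix}\begin{bmatrix}\mathbf{M}_r&\mathbf{V}_r\\ \mathbf{N}_r&\mathbf{U}_r\end{bmatrix}=I.$$ SLP constraints on $(\mathbf{R},\mathbf{M},\mathbf{N},\mathbf{L})$: $$\begin{bmatrix}zI-A & -B_2\end{bmatrix}\begin{bmatrix}\mathbf{R}&\mathbf{N}\\ \mathbf{M}&\mathbf{L}\end{bmatrix}=\begin{bmatrix}I&0\end{bmatrix},\quad \begin{bmatrix}\mathbf{R}&\mathbf{N}\\ \mathbf{M}&\mathbf{L}\end{bmatrix}\begin{bmatrix}zI-A\\ -C_2\end{bmatrix}=\begin{bmatrix}I\\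 0\end{bmatrix},\quad \mathbf{R},\mathbf{M},\mathbf{N}\in\tfrac1z\mathcal{RH}_\infty,\ \mathbf{L}\in\mathcal{RH}_\infty.$$ IOP constraints on $(\mathbf{Y},\mathbf{U},\mathbf{W},\mathbf{Z})$: $$\begin{bmatrix}I&-\mathbf{P}_{22}\end{bmatrix}\begin{bmatrix}\mathbf{Y}&\mathbf{W}\\ \mathbf{U}&\mathbf{Z}\end{bmatrix}=\begin{bmatrix}I&0\end{bmatrix},\quad \begin{bmatrix}\mathbf{Y}&\mathbf{W}\\ \mathbf{U}&\mathbf{Z}\end{bmatrix}\begin{bmatrix}-\mathbf{P}_{22}\\ I\end{bmatrix}=\begin{bmatrix}0\\ I\end{bmatrix},\quad \mathbf{Y},\mathbf{U},\mathbf{W},\mathbf{Z}\in\mathcal{RH}_\infty.$$ Meaning of "equivalent": the substitution $(\mathbf{R},\mathbf{M},\mathbf{N},\mathbf{L})=(f_1,f_2,f_3,f_4)(\mathbf{Q})$ (respectively $(\hat f_1,\hat f_2,\hat f_3,\hat f_4)(\mathbf{U})$) maps the feasible set of (Y) (respectively (IO)) onto the feasible set of (SLS), with the same objective value at corresponding points; in particular the optimal values coincide. A problem is convex if its feasible set is convex and its objective is a convex functional. *)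

theory Defs
  imports
    "HOL-Analysis.Analysis"
    "HOL-Computational_Algebra.Computational_Algebra"
    "HOL-Computational_Algebra.Field_as_Ring"
begin

section \<open>Real vector space structure on rational functions\<close>

instantiation poly :: ("{comm_ring_1, real_algebra_1}") real_algebra_1
begin

definition scaleR_poly :: "real \<Rightarrow> 'a poly \<Rightarrow> 'a poly"
  where "scaleR_poly r p = smult (of_real r) p"

instance
  by standard (simp_all add: scaleR_poly_def smult_add_right smult_add_left)

end

instantiation fract :: ("{idom, real_algebra_1}") real_vector
begin

definition scaleR_fract :: "real \<Rightarrow> 'a fract \<Rightarrow> 'a fract"
  where "scaleR_fract r x = Fraction_Field.Fract (of_real r) 1 * x"

instance
proof
  fix a b :: real and x y :: "'a fract"
  show "a *\<^sub>R (x + y) = a *\<^sub>R x + a *\<^sub>R y"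
    by (simp add: scaleR_fract_def distrib_left)
  have "Fraction_Field.Fract (of_real (a + b)) 1
      = Fraction_Field.Fract (of_real a) 1 + Fraction_Field.Fract (of_real b :: 'a) 1"
    by simp
  then show "(a + b) *\<^sub>R x = a *\<^sub>R x + b *\<^sub>R x"
    by (simp only: scaleR_fract_def distrib_right)
  show "a *\<^sub>R b *\<^sub>R x = (a * b) *\<^sub>R x"
    by (simp add: scaleR_fract_def flip: mult.assoc)
  show "1 *\<^sub>R x = x"
    by (simp add: scaleR_fract_def flip: One_fract_def)
qed

end


section \<open>Transfer matrices\<close>

type_synonym ratfun = "real poly fract"

text \<open>As for \<^typ>\<open>real ^ 'c ^ 'r\<close>, a matrix has type \<open>ratfun ^ 'c ^ 'r\<close>, where \<open>'r\<close> indexes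
  the rows and \<open>'c\<close> the columns; block matrices are indexed by sum types.\<close>

definition zvar :: ratfun
  where "zvar = Fraction_Field.Fract [:0, 1:] 1"

definition const_tm :: "real ^ 'c ^ 'r \<Rightarrow> ratfun ^ 'c ^ 'r"
  where "const_tm A = (\<chi> i j. Fraction_Field.Fract [:A $ i $ j:] 1)"

definition zI_minus :: "real ^ 'n ^ 'n \<Rightarrow> ratfun ^ 'n ^ 'n"
  where "zI_minus A = mat zvar - const_tm A"

definition resolvent :: "real ^ 'n ^ 'n \<Rightarrow> ratfun ^ 'n ^ 'n"
  where "resolvent A = matrix_inv (zI_minus A)"

definition hblock :: "'a ^ 'c1 ^ 'r \<Rightarrow> 'a ^ 'c2 ^ 'r \<Rightarrow> 'a ^ ('c1 + 'c2) ^ 'r"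
  where "hblock X Y = (\<chi> i j. case j of Inl k \<Rightarrow> X $ i $ k | Inr k \<Rightarrow> Y $ i $ k)"

definition vblock :: "'a ^ 'c ^ 'r1 \<Rightarrow> 'a ^ 'c ^ 'r2 \<Rightarrow> 'a ^ 'c ^ ('r1 + 'r2)"
  where "vblock X Y = (\<chi> i. case i of Inl k \<Rightarrow> X $ k | Inr k \<Rightarrow> Y $ k)"

definition block4 ::
  "'a ^ 'c1 ^ 'r1 \<Rightarrow> 'a ^ 'c2 ^ 'r1 \<Rightarrow> 'a ^ 'c1 ^ 'r2 \<Rightarrow> 'a ^ 'c2 ^ 'r2
    \<Rightarrow> 'a ^ ('c1 + 'c2) ^ ('r1 + 'r2)"
  where "block4 X11 X12 X21 X22 = vblock (hblock X11 X12) (hblock X21 X22)"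

text \<open>\<open>quot_of_fract x\<close> is the pair of numerator and monic denominator of \<open>x\<close> in lowest terms.\<close>

definition rf_num :: "ratfun \<Rightarrow> real poly"
  where "rf_num x = fst (quot_of_fract x)"

definition rf_den :: "ratfun \<Rightarrow> real poly"
  where "rf_den x = snd (quot_of_fract x)"

definition rf_poles :: "ratfun \<Rightarrow> complex set"
  where "rf_poles x = {s. poly (map_poly complex_of_real (rf_den x)) s = 0}"

definition rf_stable :: "ratfun \<Rightarrow> bool"
  where "rf_stable x \<longleftrightarrow> (\<forall>s\<in>rf_poles x. cmod s < 1)"

definition rf_proper :: "ratfun \<Rightarrow> bool"
  where "rf_proper x \<longleftrightarrow> degree (rf_num x) \<le> degree (rf_den x)"

text \<open>The zero function is listed separately because \<^const>\<open>degree\<close> assigns degree 0 to the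
  zero polynomial.\<close>

definition rf_strictly_proper :: "ratfun \<Rightarrow> bool"
  where "rf_strictly_proper x \<longleftrightarrow> x = 0 \<or> degree (rf_num x) < degree (rf_den x)"

definition RH_inf :: "(ratfun ^ 'c ^ 'r) set"
  where "RH_inf = {G. \<forall>i j. rf_proper (G $ i $ j) \<and> rf_stable (G $ i $ j)}"

definition RH_inf_sp :: "(ratfun ^ 'c ^ 'r) set"
  where "RH_inf_sp = {G. \<forall>i j. rf_strictly_proper (G $ i $ j) \<and> rf_stable (G $ i $ j)}"


section \<open>Discrete-time stabilizability and detectability\<close>

definition schur_stable :: "real ^ 'n ^ 'n \<Rightarrow> bool"
  where "schur_stable A \<longleftrightarrow>
    (\<forall>s v. v \<noteq> 0 \<and> (\<chi> i j. complex_of_real (A $ i $ j)) *v v = s *s v \<longrightarrow> cmod s < 1)"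

definition stabilizable :: "real ^ 'n ^ 'n \<Rightarrow> real ^ 'm ^ 'n \<Rightarrow> bool"
  where "stabilizable A B \<longleftrightarrow> (\<exists>F :: real ^ 'n ^ 'm. schur_stable (A + B ** F))"

definition detectable :: "real ^ 'n ^ 'n \<Rightarrow> real ^ 'n ^ 'p \<Rightarrow> bool"
  where "detectable A C \<longleftrightarrow> (\<exists>H :: real ^ 'p ^ 'n. schur_stable (A + H ** C))"


section \<open>Plant, factorizations and parameterizations\<close>

definition plant22 ::
  "real ^ 'n ^ 'n \<Rightarrow> real ^ 'm ^ 'n \<Rightarrow> real ^ 'n ^ 'p \<Rightarrow> ratfun ^ 'm ^ 'p"
  where "plant22 A B2 C2 = const_tm C2 ** resolvent A ** const_tm B2"

definition doubly_coprime_factorization ::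
  "ratfun ^ 'm ^ 'p \<Rightarrow> ratfun ^ 'm ^ 'm \<Rightarrow> ratfun ^ 'p ^ 'm \<Rightarrow> ratfun ^ 'm ^ 'p \<Rightarrow> ratfun ^ 'p ^ 'p
    \<Rightarrow> ratfun ^ 'p ^ 'p \<Rightarrow> ratfun ^ 'p ^ 'm \<Rightarrow> ratfun ^ 'm ^ 'p \<Rightarrow> ratfun ^ 'm ^ 'm \<Rightarrow> bool"
  where "doubly_coprime_factorization P Ul Vl Nl Ml Ur Vr Nr Mr \<longleftrightarrow>
    Ul \<in> RH_inf \<and> Vl \<in> RH_inf \<and> Nl \<in> RH_inf \<and> Ml \<in> RH_inf \<and>
    Ur \<in> RH_inf \<and> Vr \<in> RH_inf \<and> Nr \<in> RH_inf \<and> Mr \<in> RH_inf \<and>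
    invertible Mr \<and> invertible Ml \<and>
    P = Nr ** matrix_inv Mr \<and> P = matrix_inv Ml ** Nl \<and>
    block4 Ul (- Vl) (- Nl) Ml ** block4 Mr Vr Nr Ur = mat 1"

type_synonym ('n, 'm, 'p) slp =
  "(ratfun ^ 'n ^ 'n) \<times> (ratfun ^ 'n ^ 'm) \<times> (ratfun ^ 'p ^ 'n) \<times> (ratfun ^ 'p ^ 'm)"

type_synonym ('m, 'p) iop =
  "(ratfun ^ 'p ^ 'p) \<times> (ratfun ^ 'p ^ 'm) \<times> (ratfun ^ 'm ^ 'p) \<times> (ratfun ^ 'm ^ 'm)"

text \<open>Quadruples are ordered \<open>(R, M, N, L)\<close> and \<open>(Y, U, W, Z)\<close>; the second and third components
  swap places in the block matrices.\<close>

definition slp_block :: "('n::finite, 'm::finite, 'p::finite) slp \<Rightarrow> ratfun ^ ('n + 'p) ^ ('n + 'm)"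
  where "slp_block = (\<lambda>(R, M, N, L). block4 R N M L)"

definition slp_set ::
  "real ^ 'n ^ 'n \<Rightarrow> real ^ 'm ^ 'n \<Rightarrow> real ^ 'n ^ 'p \<Rightarrow> ('n, 'm, 'p) slp set"
  where "slp_set A B2 C2 = {(R, M, N, L).
    hblock (zI_minus A) (- const_tm B2) ** block4 R N M L = hblock (mat 1) 0 \<and>
    block4 R N M L ** vblock (zI_minus A) (- const_tm C2) = vblock (mat 1) 0 \<and>
    R \<in> RH_inf_sp \<and> M \<in> RH_inf_sp \<and> N \<in> RH_inf_sp \<and> L \<in> RH_inf}"

definition iop_set :: "ratfun ^ 'm ^ 'p \<Rightarrow> ('m, 'p) iop set"
  where "iop_set P = {(Y, U, W, Z).
    hblock (mat 1) (- P) ** block4 Y W U Z = hblock (mat 1) 0 \<and>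
    block4 Y W U Z ** vblock (- P) (mat 1) = vblock 0 (mat 1) \<and>
    Y \<in> RH_inf \<and> U \<in> RH_inf \<and> W \<in> RH_inf \<and> Z \<in> RH_inf}"

definition slp_of_youla ::
  "real ^ 'n ^ 'n \<Rightarrow> real ^ 'm ^ 'n \<Rightarrow> real ^ 'n ^ 'p
    \<Rightarrow> ratfun ^ 'p ^ 'm \<Rightarrow> ratfun ^ 'm ^ 'm \<Rightarrow> ratfun ^ 'p ^ 'p
    \<Rightarrow> ratfun ^ 'p ^ 'm \<Rightarrow> ('n, 'm, 'p) slp"
  where "slp_of_youla A B2 C2 Vr Mr Ml Q =
    (resolvent A + resolvent A ** const_tm B2 ** (Vr - Mr ** Q) ** Ml ** const_tm C2 ** resolvent A,
     (Vr - Mr ** Q) ** Ml ** const_tm C2 ** resolvent A,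
     resolvent A ** const_tm B2 ** (Vr - Mr ** Q) ** Ml,
     (Vr - Mr ** Q) ** Ml)"

definition slp_of_iop ::
  "real ^ 'n ^ 'n \<Rightarrow> real ^ 'm ^ 'n \<Rightarrow> real ^ 'n ^ 'p \<Rightarrow> ratfun ^ 'p ^ 'm \<Rightarrow> ('n, 'm, 'p) slp"
  where "slp_of_iop A B2 C2 U =
    (resolvent A + resolvent A ** const_tm B2 ** U ** const_tm C2 ** resolvent A,
     U ** const_tm C2 ** resolvent A,
     resolvent A ** const_tm B2 ** U,
     U)"


section \<open>Optimization problems\<close>

definition sls_feasible ::
  "real ^ 'n ^ 'n \<Rightarrow> real ^ 'm ^ 'n \<Rightarrow> real ^ 'n ^ 'p
    \<Rightarrow> (ratfun ^ ('n + 'p) ^ ('n + 'm)) set \<Rightarrow> ('n, 'm, 'p) slp set"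
  where "sls_feasible A B2 C2 S = {X \<in> slp_set A B2 C2. slp_block X \<in> S}"

definition youla_feasible ::
  "real ^ 'n ^ 'n \<Rightarrow> real ^ 'm ^ 'n \<Rightarrow> real ^ 'n ^ 'p
    \<Rightarrow> ratfun ^ 'p ^ 'm \<Rightarrow> ratfun ^ 'm ^ 'm \<Rightarrow> ratfun ^ 'p ^ 'p
    \<Rightarrow> (ratfun ^ ('n + 'p) ^ ('n + 'm)) set \<Rightarrow> (ratfun ^ 'p ^ 'm) set"
  where "youla_feasible A B2 C2 Vr Mr Ml S =
    {Q \<in> RH_inf. slp_block (slp_of_youla A B2 C2 Vr Mr Ml Q) \<in> S}"

definition iop_feasible ::
  "real ^ 'n ^ 'n \<Rightarrow> real ^ 'm ^ 'n \<Rightarrow> real ^ 'n ^ 'p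
    \<Rightarrow> (ratfun ^ ('n + 'p) ^ ('n + 'm)) set \<Rightarrow> ('m, 'p) iop set"
  where "iop_feasible A B2 C2 S =
    {(Y, U, W, Z). (Y, U, W, Z) \<in> iop_set (plant22 A B2 C2) \<and> slp_block (slp_of_iop A B2 C2 U) \<in> S}"

text \<open>A problem is given by its feasible set and its objective. The problem \<open>(F1, J1)\<close> is
  equivalent to \<open>(F2, J2)\<close> under the substitution \<open>\<phi>\<close> if \<open>\<phi>\<close> maps \<open>F1\<close> onto \<open>F2\<close> and preserves
  objective values. The last conjunct, equality of the optimal values, follows from the other
  two; in \<^typ>\<open>ereal\<close> it also covers infeasible and unbounded problems.\<close>

definition equivalent_under ::
  "('x \<Rightarrow> 'y) \<Rightarrow> 'x set \<Rightarrow> ('x \<Rightarrow> real) \<Rightarrow> 'y set \<Rightarrow> ('y \<Rightarrow> real) \<Rightarrow> bool"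
  where "equivalent_under \<phi> F1 J1 F2 J2 \<longleftrightarrow>
    \<phi> ` F1 = F2 \<and> (\<forall>x\<in>F1. J1 x = J2 (\<phi> x)) \<and>
    (INF x\<in>F1. ereal (J1 x)) = (INF y\<in>F2. ereal (J2 y))"

text \<open>Here \<open>D\<close> is the domain on which the objective \<open>J\<close> is considered as a convex functional;
  objectives finite at every transfer matrix have \<open>D = UNIV\<close>, whereas norm-like objectives are
  finite on a smaller set only.\<close>

definition convex_problem :: "'x :: real_vector set \<Rightarrow> 'x set \<Rightarrow> ('x \<Rightarrow> real) \<Rightarrow> bool"
  where "convex_problem D F J \<longleftrightarrow> F \<subseteq> D \<and> convex F \<and> convex_on D J"

end

theory Submission
  imports Defs
begin

text \<open>The affine constraints leave one free parameter in each problem: \<open>L\<close> determines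
  \<open>(R, M, N)\<close> and \<open>U\<close> determines \<open>(Y, W, Z)\<close>, so with \<open>L = U\<close> only the stability
  conditions have to be compared. The SLP maps are turned into the IOP maps by multiplication with
  \<open>C\<^sub>2\<close> and \<open>B\<^sub>2\<close>. Conversely, stabilizing gains \<open>F\<close> and \<open>H\<close> give the identities
  \<open>(zI - A)\<^sup>-\<^sup>1 = G - (zI - A)\<^sup>-\<^sup>1 B\<^sub>2 F G = E - E H C\<^sub>2 (zI - A)\<^sup>-\<^sup>1\<close> with the strictly proper
  stable resolvents \<open>G\<close> and \<open>E\<close> of \<open>A + B\<^sub>2 F\<close> and \<open>A + H C\<^sub>2\<close>, which express the SLP maps
  through \<open>G\<close>, \<open>E\<close> and the IOP maps. Given a feasible \<open>U\<close>, the parameter \<open>Q\<close> solving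
  \<open>U = (V\<^sub>r - M\<^sub>r Q) M\<^sub>l\<close> is stable because the four products of \<open>M\<^sub>r\<close> or \<open>N\<^sub>r\<close> with \<open>Q\<close> and
  \<open>M\<^sub>l\<close> or \<open>N\<^sub>l\<close> are, and the two Bezout identities recover \<open>Q\<close> from them. Convexity is
  inherited since all substitutions are affine.\<close>

section \<open>Stable rational functions\<close>

lemma map_poly_of_real_add:
  "map_poly complex_of_real (p + q) = map_poly of_real p + map_poly of_real q"
  by (rule poly_eqI) (simp add: coeff_map_poly)

lemma map_poly_of_real_mult:
  "map_poly complex_of_real (p * q) = map_poly of_real p * map_poly of_real q"
  by (rule poly_eqI) (simp add: coeff_map_poly coeff_mult)

text \<open>A condition on an arbitrary denominator, not only on the reduced one, so that it can be
  checked on unreduced fractions. The zero polynomial fails it.\<close>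

definition schur_poly :: "real poly \<Rightarrow> bool"
  where "schur_poly q \<longleftrightarrow> (\<forall>s. poly (map_poly complex_of_real q) s = 0 \<longrightarrow> cmod s < 1)"

lemma schur_poly_1 [simp]: "schur_poly 1"
  by (simp add: schur_poly_def)

lemma schur_poly_mult: "schur_poly p \<Longrightarrow> schur_poly q \<Longrightarrow> schur_poly (p * q)"
  by (auto simp: schur_poly_def map_poly_of_real_mult)

lemma schur_poly_dvd: "schur_poly q \<Longrightarrow> p dvd q \<Longrightarrow> schur_poly p"
  by (auto simp: schur_poly_def map_poly_of_real_mult elim!: dvdE)

definition sproper :: "ratfun \<Rightarrow> bool"
  where "sproper x \<longleftrightarrow> rf_proper x \<and> rf_stable x"

definition ssproper :: "ratfun \<Rightarrow> bool"
  where "ssproper x \<longleftrightarrow> rf_strictly_proper x \<and> rf_stable x"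

text \<open>Cross-multiplying the given fraction with the reduced one gives the equation.
  Coprimality of the reduced pair then turns it into divisibility, so every root of the reduced
  denominator is a root of \<open>q\<close>.\<close>

lemma rf_num_den:
  assumes "q \<noteq> 0" and x: "x = to_fract p / to_fract q"
  shows "rf_den x dvd q" and "p * rf_den x = rf_num x * q" and "rf_den x \<noteq> 0"
proof -
  show nz: "rf_den x \<noteq> 0" by (simp add: rf_den_def)
  have "to_fract p / to_fract q = to_fract (rf_num x) / to_fract (rf_den x)"
    by (metis Fract_conv_to_fract Fract_quot_of_fract rf_num_def rf_den_def x)
  then have "to_fract p * to_fract (rf_den x) = to_fract (rf_num x) * to_fract q"
    using assms(1) nz by (simp only: frac_eq_eq to_fract_eq_0_iff not_False_eq_True)
  then show eq: "p * rf_den x = rf_num x * q"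
    by (metis to_fract_eq_iff to_fract_mult)
  have "coprime (rf_den x) (rf_num x)"
    by (simp add: rf_num_def rf_den_def coprime_quot_of_fract coprime_commute)
  then show "rf_den x dvd q"
    using eq by (metis coprime_dvd_mult_right_iff dvd_triv_right)
qed

lemma degree_cross_mult:
  fixes p q n d :: "'a::idom poly"
  assumes "p * d = n * q" "q \<noteq> 0" "d \<noteq> 0" "p \<noteq> 0"
  shows "degree p + degree d = degree n + degree q"
  using assms by (metis degree_mult_eq mult_eq_0_iff)

text \<open>Frees the closure proofs from reduction to lowest terms: the relative degree does not
  depend on the chosen fraction, and the reduced denominator inherits the Schur property as a
  divisor of \<open>q\<close>.\<close>

lemma sproper_iff:
  "sproper x \<longleftrightarrow>
    (\<exists>p q. q \<noteq> 0 \<and> x = to_fract p / to_fract q \<and> degree p \<le> degree q \<and> schur_poly q)"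
proof
  assume "sproper x"
  then show "\<exists>p q. q \<noteq> 0 \<and> x = to_fract p / to_fract q \<and> degree p \<le> degree q \<and> schur_poly q"
    by (intro exI[of _ "rf_num x"] exI[of _ "rf_den x"])
      (auto simp: sproper_def rf_proper_def rf_stable_def rf_poles_def schur_poly_def
        rf_num_def rf_den_def simp flip: Fract_conv_to_fract)
next
  assume "\<exists>p q. q \<noteq> 0 \<and> x = to_fract p / to_fract q \<and> degree p \<le> degree q \<and> schur_poly q"
  then obtain p q where pq: "q \<noteq> 0" "x = to_fract p / to_fract q" "degree p \<le> degree q" "schur_poly q"
    by blast
  note r = rf_num_den[OF pq(1,2)]
  have "rf_proper x"
  proof (cases "p = 0")
    case True
    then show ?thesis using pq by (simp add: rf_proper_def rf_num_def)
  next
    case False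
    then show ?thesis
      using degree_cross_mult[OF r(2) pq(1) r(3)] pq(3) by (simp add: rf_proper_def)
  qed
  then show "sproper x"
    using schur_poly_dvd[OF pq(4) r(1)]
    by (auto simp: sproper_def rf_stable_def rf_poles_def schur_poly_def)
qed

lemma ssproper_iff:
  "ssproper x \<longleftrightarrow>
    (\<exists>p q. q \<noteq> 0 \<and> x = to_fract p / to_fract q \<and> (p = 0 \<or> degree p < degree q) \<and> schur_poly q)"
proof
  assume "ssproper x"
  then show "\<exists>p q. q \<noteq> 0 \<and> x = to_fract p / to_fract q \<and> (p = 0 \<or> degree p < degree q) \<and> schur_poly q"
    by (intro exI[of _ "rf_num x"] exI[of _ "rf_den x"])
      (auto simp: ssproper_def rf_strictly_proper_def rf_stable_def rf_poles_def schur_poly_def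
        rf_num_def rf_den_def simp flip: Fract_conv_to_fract)
next
  assume "\<exists>p q. q \<noteq> 0 \<and> x = to_fract p / to_fract q \<and> (p = 0 \<or> degree p < degree q) \<and> schur_poly q"
  then obtain p q where pq: "q \<noteq> 0" "x = to_fract p / to_fract q"
    "p = 0 \<or> degree p < degree q" "schur_poly q"
    by blast
  note r = rf_num_den[OF pq(1,2)]
  have "rf_strictly_proper x"
  proof (cases "p = 0")
    case True
    then show ?thesis using pq by (simp add: rf_strictly_proper_def)
  next
    case False
    then show ?thesis
      using degree_cross_mult[OF r(2) pq(1) r(3)] pq(3) by (simp add: rf_strictly_proper_def)
  qed
  then show "ssproper x"
    using schur_poly_dvd[OF pq(4) r(1)]
    by (auto simp: ssproper_def rf_stable_def rf_poles_def schur_poly_def)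
qed

section \<open>Closure of proper and strictly proper stable functions under ring operations\<close>

lemma ssproper_imp_sproper: "ssproper x \<Longrightarrow> sproper x"
  unfolding ssproper_iff sproper_iff by (metis degree_0 less_imp_le zero_le)

lemma sproper_to_fract_const: "sproper (to_fract [:a:])"
  unfolding sproper_iff by (intro exI[of _ "[:a:]"] exI[of _ 1]) simp

lemma sproper_add:
  assumes "sproper x" "sproper y" shows "sproper (x + y)"
proof -
  obtain p q where 1: "q \<noteq> 0" "x = to_fract p / to_fract q" "degree p \<le> degree q" "schur_poly q"
    using assms(1) unfolding sproper_iff by blast
  obtain p' q' where 2: "q' \<noteq> 0" "y = to_fract p' / to_fract q'" "degree p' \<le> degree q'" "schur_poly q'"
    using assms(2) unfolding sproper_iff by blast
  have "degree (p * q' + p' * q) \<le> degree (q * q')"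
    using 1 2 by (intro degree_add_le order_trans[OF degree_mult_le]) (auto simp: degree_mult_eq)
  then show ?thesis unfolding sproper_iff using 1 2
    by (intro exI[of _ "p * q' + p' * q"] exI[of _ "q * q'"]) (simp add: field_simps schur_poly_mult)
qed

lemma sproper_mult:
  assumes "sproper x" "sproper y" shows "sproper (x * y)"
proof -
  obtain p q where 1: "q \<noteq> 0" "x = to_fract p / to_fract q" "degree p \<le> degree q" "schur_poly q"
    using assms(1) unfolding sproper_iff by blast
  obtain p' q' where 2: "q' \<noteq> 0" "y = to_fract p' / to_fract q'" "degree p' \<le> degree q'" "schur_poly q'"
    using assms(2) unfolding sproper_iff by blast
  have "degree (p * p') \<le> degree (q * q')"
    using 1 2 by (intro order_trans[OF degree_mult_le]) (auto simp: degree_mult_eq)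
  then show ?thesis unfolding sproper_iff using 1 2
    by (intro exI[of _ "p * p'"] exI[of _ "q * q'"]) (simp add: schur_poly_mult)
qed

lemma ssproper_add:
  assumes "ssproper x" "ssproper y" shows "ssproper (x + y)"
proof -
  obtain p q where 1: "q \<noteq> 0" "x = to_fract p / to_fract q" "p = 0 \<or> degree p < degree q" "schur_poly q"
    using assms(1) unfolding ssproper_iff by blast
  obtain p' q' where 2: "q' \<noteq> 0" "y = to_fract p' / to_fract q'" "p' = 0 \<or> degree p' < degree q'" "schur_poly q'"
    using assms(2) unfolding ssproper_iff by blast
  have "p * q' = 0 \<or> degree (p * q') < degree (q * q')" "p' * q = 0 \<or> degree (p' * q) < degree (q * q')"
    using 1(1,3) 2(1,3) degree_mult_le[of p q'] degree_mult_le[of p' q] by (auto simp: degree_mult_eq)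
  then have "p * q' + p' * q = 0 \<or> degree (p * q' + p' * q) < degree (q * q')"
    by (auto intro: degree_add_less)
  moreover have "x + y = to_fract (p * q' + p' * q) / to_fract (q * q')"
    using 1(1,2) 2(1,2) by (simp add: add_frac_eq)
  ultimately show ?thesis unfolding ssproper_iff using 1 2
    by (intro exI[of _ "p * q' + p' * q"] exI[of _ "q * q'"]) (simp add: schur_poly_mult)
qed

lemma ssproper_mult_right:
  assumes "ssproper x" "sproper y" shows "ssproper (x * y)"
proof -
  obtain p q where 1: "q \<noteq> 0" "x = to_fract p / to_fract q" "p = 0 \<or> degree p < degree q" "schur_poly q"
    using assms(1) unfolding ssproper_iff by blast
  obtain p' q' where 2: "q' \<noteq> 0" "y = to_fract p' / to_fract q'" "degree p' \<le> degree q'" "schur_poly q'"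
    using assms(2) unfolding sproper_iff by blast
  have "p * p' = 0 \<or> degree (p * p') < degree (q * q')"
    using 1(1,3) 2(1,3) degree_mult_le[of p p'] by (auto simp: degree_mult_eq)
  then show ?thesis unfolding ssproper_iff using 1 2
    by (intro exI[of _ "p * p'"] exI[of _ "q * q'"]) (simp add: schur_poly_mult)
qed

lemma ssproper_mult_left: "sproper x \<Longrightarrow> ssproper y \<Longrightarrow> ssproper (x * y)"
  using ssproper_mult_right[of y x] by (simp add: mult.commute)

lemma ssproper_0: "ssproper 0"
  unfolding ssproper_iff by (intro exI[of _ 0] exI[of _ 1]) simp

lemma sproper_0: "sproper 0" and sproper_1: "sproper 1"
  using sproper_to_fract_const[of 0] sproper_to_fract_const[of 1] by (simp_all flip: one_pCons)

lemma sproper_minus_1: "sproper (- 1)"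
  using sproper_to_fract_const[of "- 1"]
  by (metis minus_pCons minus_zero one_pCons to_fract_1 to_fract_uminus)

lemma sproper_uminus: "sproper x \<Longrightarrow> sproper (- x)"
  using sproper_mult[OF sproper_minus_1, of x] by simp

lemma sproper_sum: "(\<And>i. i \<in> I \<Longrightarrow> sproper (f i)) \<Longrightarrow> sproper (sum f I)"
  by (induction I rule: infinite_finite_induct) (auto simp: sproper_0 sproper_add)

lemma ssproper_sum: "(\<And>i. i \<in> I \<Longrightarrow> ssproper (f i)) \<Longrightarrow> ssproper (sum f I)"
  by (induction I rule: infinite_finite_induct) (auto simp: ssproper_0 ssproper_add)


section \<open>Stable transfer matrices\<close>

lemma RH_inf_iff: "G \<in> RH_inf \<longleftrightarrow> (\<forall>i j. sproper (G $ i $ j))"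
  by (auto simp: RH_inf_def sproper_def)

lemma RH_inf_sp_iff: "G \<in> RH_inf_sp \<longleftrightarrow> (\<forall>i j. ssproper (G $ i $ j))"
  by (auto simp: RH_inf_sp_def ssproper_def)

lemma RH_inf_sp_imp_RH_inf: "X \<in> RH_inf_sp \<Longrightarrow> X \<in> RH_inf"
  by (auto simp: RH_inf_iff RH_inf_sp_iff ssproper_imp_sproper)

lemma RH_inf_add: "X \<in> RH_inf \<Longrightarrow> Y \<in> RH_inf \<Longrightarrow> X + Y \<in> RH_inf"
  by (auto simp: RH_inf_iff sproper_add)

lemma RH_inf_uminus: "X \<in> RH_inf \<Longrightarrow> - X \<in> RH_inf"
  by (auto simp: RH_inf_iff sproper_uminus)

lemma RH_inf_diff: "X \<in> RH_inf \<Longrightarrow> Y \<in> RH_inf \<Longrightarrow> X - Y \<in> RH_inf"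
  using RH_inf_add[OF _ RH_inf_uminus, of X Y] by simp

lemma RH_inf_mult: "X \<in> RH_inf \<Longrightarrow> Y \<in> RH_inf \<Longrightarrow> X ** Y \<in> RH_inf"
  by (auto simp: RH_inf_iff matrix_matrix_mult_def intro!: sproper_sum sproper_mult)

lemma RH_inf_mat_1: "mat 1 \<in> RH_inf"
  by (auto simp: RH_inf_iff mat_def sproper_0 sproper_1)

lemma RH_inf_const: "const_tm M \<in> RH_inf"
  by (auto simp: RH_inf_iff const_tm_def sproper_to_fract_const simp flip: to_fract_def)

lemma RH_inf_sp_add: "X \<in> RH_inf_sp \<Longrightarrow> Y \<in> RH_inf_sp \<Longrightarrow> X + Y \<in> RH_inf_sp"
  by (auto simp: RH_inf_sp_iff ssproper_add)

lemma RH_inf_sp_uminus: "X \<in> RH_inf_sp \<Longrightarrow> - X \<in> RH_inf_sp"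
  using ssproper_mult_left[OF sproper_minus_1] by (auto simp: RH_inf_sp_iff)

lemma RH_inf_sp_diff: "X \<in> RH_inf_sp \<Longrightarrow> Y \<in> RH_inf_sp \<Longrightarrow> X - Y \<in> RH_inf_sp"
  using RH_inf_sp_add[OF _ RH_inf_sp_uminus, of X Y] by simp

lemma RH_inf_scaleR: "X \<in> RH_inf \<Longrightarrow> r *\<^sub>R X \<in> RH_inf"
  by (auto simp: RH_inf_iff scaleR_fract_def of_real_def scaleR_poly_def sproper_to_fract_const
      simp flip: to_fract_def intro!: sproper_mult)

lemma RH_inf_sp_mult_right: "X \<in> RH_inf_sp \<Longrightarrow> Y \<in> RH_inf \<Longrightarrow> X ** Y \<in> RH_inf_sp"
  by (auto simp: RH_inf_iff RH_inf_sp_iff matrix_matrix_mult_def intro!: ssproper_sum ssproper_mult_right)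

lemma RH_inf_sp_mult_left: "X \<in> RH_inf \<Longrightarrow> Y \<in> RH_inf_sp \<Longrightarrow> X ** Y \<in> RH_inf_sp"
  by (auto simp: RH_inf_iff RH_inf_sp_iff matrix_matrix_mult_def intro!: ssproper_sum ssproper_mult_left)


section \<open>The resolvent of a Schur stable matrix\<close>

text \<open>A determinant is a polynomial in the entries with integer coefficients, so ring
  homomorphisms commute with it. This serves both for the embedding into fractions and for
  evaluation at a real or complex point.\<close>

lemma det_hom:
  fixes h :: "'a::comm_ring_1 \<Rightarrow> 'b::comm_ring_1" and X :: "'a ^ 'n ^ 'n"
  assumes "\<And>a b. h (a + b) = h a + h b" "\<And>a b. h (a * b) = h a * h b" "h 1 = 1"
  shows "h (det X) = det (\<chi> i j. h (X $ i $ j))"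
proof -
  have 0: "h 0 = 0" using assms(1)[of 0 0] by simp
  have m: "h (- a) = - h a" for a
    using assms(1)[of a "- a"] 0 by (simp add: eq_neg_iff_add_eq_0 add.commute)
  have s: "h (sum f I) = (\<Sum>i\<in>I. h (f i))" for f :: "('n \<Rightarrow> 'n) \<Rightarrow> 'a" and I
    by (induction I rule: infinite_finite_induct) (auto simp: 0 assms)
  have p: "h (prod f I) = (\<Prod>i\<in>I. h (f i))" for f :: "'n \<Rightarrow> 'a" and I
    by (induction I rule: infinite_finite_induct) (auto simp: assms)
  have "h (of_int (sign q)) = of_int (sign q)" for q :: "'n \<Rightarrow> 'n"
    by (simp add: sign_def m assms(3))
  then show ?thesis
    by (simp add: det_def s p assms(2))
qed

text \<open>The matrix \<open>zI - A\<close> over the polynomials, where degrees and evaluation are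
  available.\<close>

definition char_mat :: "real ^ 'n ^ 'n \<Rightarrow> real poly ^ 'n ^ 'n"
  where "char_mat A = (\<chi> i j. (if i = j then [:0, 1:] else 0) - [:A $ i $ j:])"

lemma zI_minus_char_mat: "zI_minus A = (\<chi> i j. to_fract (char_mat A $ i $ j))"
  by (simp add: zI_minus_def char_mat_def vec_eq_iff mat_def const_tm_def zvar_def to_fract_def
      del: diff_pCons)

lemma det_zI_minus: "det (zI_minus A) = to_fract (det (char_mat A))"
  unfolding zI_minus_char_mat by (rule det_hom[symmetric]) simp_all

lemma matrix_singular_kernel:
  fixes X :: "'a::field ^ 'n ^ 'n"
  assumes "det X = 0"
  obtains v where "v \<noteq> 0" "X *v v = 0"
  using assms invertible_det_nz[of X] invertible_left_inverse[of X] matrix_left_invertible_ker[of X]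
  by blast

text \<open>At a real point \<open>s\<close> above the operator norm of \<open>A\<close>, a kernel
  vector of \<open>s I - A\<close> would be stretched by \<open>A\<close> more than the norm allows.
  Hence the determinant does not vanish at \<open>s\<close>.\<close>

lemma det_char_mat_nonzero: "det (char_mat A) \<noteq> 0"
proof
  assume 0: "det (char_mat A) = 0"
  define s where "s = onorm ((*v) A) + 1"
  define X where "X = (\<chi> i j. poly (char_mat A $ i $ j) s)"
  have "poly (det (char_mat A)) s = det X"
    unfolding X_def by (rule det_hom) simp_all
  then obtain v where v: "v \<noteq> 0" "X *v v = 0"
    using 0 matrix_singular_kernel[of X] by auto
  have "X = s *\<^sub>R mat 1 - A"
    by (simp add: X_def char_mat_def vec_eq_iff mat_def)
  with v(2) have "s *\<^sub>R v = A *v v"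
    by (simp add: matrix_vector_mult_diff_rdistrib scaleR_matrix_vector_assoc[symmetric])
  then have "\<bar>s\<bar> * norm v = norm (A *v v)"
    by (metis norm_scaleR)
  also have "\<dots> \<le> onorm ((*v) A) * norm v"
    by (intro onorm matrix_vector_mul_bounded_linear)
  finally have "\<bar>s\<bar> \<le> onorm ((*v) A)" using v(1) by simp
  then show False by (simp add: s_def)
qed

lemma invertible_zI_minus: "invertible (zI_minus A)"
  by (simp add: invertible_det_nz det_zI_minus det_char_mat_nonzero)

lemma
  shows zI_minus_resolvent: "zI_minus A ** resolvent A = mat 1"
    and resolvent_zI_minus: "resolvent A ** zI_minus A = mat 1"
proof -
  have "\<exists>B. zI_minus A ** B = mat 1 \<and> B ** zI_minus A = mat 1"
    using invertible_zI_minus[of A] unfolding invertible_def .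
  from someI_ex[OF this] show "zI_minus A ** resolvent A = mat 1" "resolvent A ** zI_minus A = mat 1"
    by (simp_all add: resolvent_def matrix_inv_def)
qed

text \<open>Cramer's rule for the \<open>j\<close>-th column of the resolvent, with the
  \<open>j\<close>-th unit vector as right-hand side, yields one common denominator for all
  entries.\<close>

lemma resolvent_entry:
  obtains p where "\<And>i j. resolvent A $ i $ j = to_fract (p i j) / to_fract (det (char_mat A))"
proof
  fix i j
  let ?p = "\<lambda>i j. det (\<chi> k l. if l = i then (if k = j then 1 else 0) else char_mat A $ k $ l)"
  define x where "x = column j (resolvent A)"
  define b :: "ratfun ^ 'a" where "b = (\<chi> k. if k = j then 1 else 0)"
  have "(zI_minus A *v x) $ k = (zI_minus A ** resolvent A) $ k $ j" for k
    by (simp add: x_def column_def matrix_vector_mult_def matrix_matrix_mult_def)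
  then have "zI_minus A *v x = b"
    by (simp add: vec_eq_iff zI_minus_resolvent b_def mat_def)
  then have "x $ i = det (\<chi> k l. if l = i then b $ k else zI_minus A $ k $ l) / det (zI_minus A)"
    using cramer[of "zI_minus A" x b] invertible_zI_minus[of A]
    by (simp add: invertible_det_nz)
  moreover have "det (\<chi> k l. if l = i then b $ k else zI_minus A $ k $ l) = to_fract (?p i j)"
  proof (subst det_hom[of to_fract])
    show "det (\<chi> k l. if l = i then b $ k else zI_minus A $ k $ l) =
      det (\<chi> k l. to_fract ((\<chi> k l. if l = i then if k = j then 1 else 0 else char_mat A $ k $ l) $ k $ l))"
      by (rule arg_cong[of _ _ det]) (simp add: vec_eq_iff b_def zI_minus_char_mat)
  qed simp_all
  ultimately show "resolvent A $ i $ j = to_fract (?p i j) / to_fract (det (char_mat A))"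
    by (simp add: x_def column_def det_zI_minus)
qed

text \<open>At a complex root \<open>s\<close> of the determinant the evaluated matrix
  \<open>s I - A\<close> is singular, and a kernel vector is an eigenvector of \<open>A\<close> for
  \<open>s\<close>.\<close>

lemma schur_poly_det_char_mat:
  assumes "schur_stable A"
  shows "schur_poly (det (char_mat A))"
  unfolding schur_poly_def
proof (intro allI impI)
  fix s
  assume s: "poly (map_poly complex_of_real (det (char_mat A))) s = 0"
  define X where "X = (\<chi> i j. poly (map_poly complex_of_real (char_mat A $ i $ j)) s)"
  have "poly (map_poly complex_of_real (det (char_mat A))) s = det X"
    unfolding X_def
    by (rule det_hom[where h = "\<lambda>p. poly (map_poly complex_of_real p) s"])
      (simp_all add: map_poly_of_real_add map_poly_of_real_mult)
  then obtain v where v: "v \<noteq> 0" "X *v v = 0"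
    using s matrix_singular_kernel[of X] by auto
  have "X = mat s - (\<chi> i j. complex_of_real (A $ i $ j))"
    by (simp add: X_def char_mat_def vec_eq_iff mat_def map_poly_pCons)
  moreover have "mat s *v v = s *s v"
    by (simp add: vec_eq_iff matrix_vector_mult_def mat_def if_distrib if_distribR cong: if_cong)
  ultimately have "(\<chi> i j. complex_of_real (A $ i $ j)) *v v = s *s v"
    using v(2) by (simp add: matrix_vector_mult_diff_rdistrib)
  then show "cmod s < 1"
    using assms v(1) unfolding schur_stable_def by blast
qed

text \<open>In \<open>z r\<^sub>i = (A r)\<^sub>i + q b\<^sub>i\<close> choose \<open>r\<^sub>i\<close> of maximal degree: the left-hand side then
  exceeds the degree of \<open>A r\<close>, so it is bounded by that of \<open>q b\<^sub>i\<close>.\<close>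

lemma degree_less_of_char_mat_mult:
  fixes r w :: "'n::finite \<Rightarrow> real poly" and A :: "real ^ 'n ^ 'n"
  assumes eq: "\<And>i. (\<Sum>k\<in>UNIV. char_mat A $ i $ k * r k) = w i"
    and w: "\<And>i. degree (w i) \<le> e"
  shows "r i = 0 \<or> degree (r i) < e"
proof (rule ccontr)
  assume neg: "\<not> (r i = 0 \<or> degree (r i) < e)"
  define d where "d = Max ((\<lambda>k. degree (r k)) ` UNIV)"
  have le: "degree (r k) \<le> d" for k by (simp add: d_def)
  obtain k where k: "degree (r k) = d"
    by (metis (mono_tags, lifting) Max_in UNIV_not_empty d_def finite finite_imageI imageE image_is_empty)
  \<comment> \<open>For \<open>d = 0\<close> the polynomial \<open>r k\<close> of maximal degree may
    be zero, so the index \<open>i\<close>, where \<open>r i\<close> is nonzero by assumption, is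
    taken instead.\<close>
  define m where "m = (if d = 0 then i else k)"
  have m: "degree (r m) = d" "r m \<noteq> 0"
    using k le[of i] neg by (auto simp: m_def)
  have "e \<le> d" using neg le[of i] by auto
  have "(\<Sum>k\<in>UNIV. char_mat A $ m $ k * r k) = [:0, 1:] * r m - (\<Sum>k\<in>UNIV. smult (A $ m $ k) (r k))"
    by (simp add: char_mat_def left_diff_distrib sum_subtractf if_distrib[of "\<lambda>x. x * _"]
        cong: if_cong del: diff_pCons mult_pCons_left) simp
  then have "[:0, 1:] * r m = w m + (\<Sum>k\<in>UNIV. smult (A $ m $ k) (r k))"
    using eq[of m] by (simp add: algebra_simps)
  moreover have "degree (w m + (\<Sum>k\<in>UNIV. smult (A $ m $ k) (r k))) \<le> d"
    using w[of m] \<open>e \<le> d\<close> le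
    by (intro degree_add_le degree_sum_le) (auto intro: order_trans[OF degree_smult_le])
  moreover have "degree ([:0, 1:] * r m) = Suc d"
    using m by (simp add: degree_mult_eq)
  ultimately show False by simp
qed

lemma to_fract_sum: "to_fract (sum f I) = (\<Sum>k\<in>I. to_fract (f k))"
  by (induction I rule: infinite_finite_induct) auto

text \<open>Stability comes from the eigenvalues through the common denominator \<open>q\<close>.
  For strict properness, the numerators of each column solve a polynomial system with matrix
  \<open>char_mat A\<close> whose right-hand side has degree at most that of
  \<open>q\<close>.\<close>

lemma resolvent_in_RH_inf_sp:
  assumes "schur_stable A"
  shows "resolvent A \<in> RH_inf_sp"
proof -
  define q where "q = det (char_mat A)"
  have q: "q \<noteq> 0" by (simp add: q_def det_char_mat_nonzero)
  obtain p where p: "\<And>i j. resolvent A $ i $ j = to_fract (p i j) / to_fract q"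
    using resolvent_entry unfolding q_def by blast
  have "p i j = 0 \<or> degree (p i j) < degree q" for i j
  proof (rule degree_less_of_char_mat_mult[where r = "\<lambda>i. p i j" and A = A
        and w = "\<lambda>i. if i = j then q else 0"])
    fix i
    have "(\<Sum>k\<in>UNIV. to_fract (char_mat A $ i $ k) * (to_fract (p k j) / to_fract q))
        = (if i = j then 1 else 0)"
      using arg_cong[OF zI_minus_resolvent[of A], of "\<lambda>X. X $ i $ j"]
      by (simp add: matrix_matrix_mult_def p zI_minus_char_mat mat_def)
    then have "(\<Sum>k\<in>UNIV. to_fract (char_mat A $ i $ k) * to_fract (p k j)) = to_fract (if i = j then q else 0)"
      using q by (auto simp: divide_eq_eq simp flip: sum_divide_distrib split: if_splits)
    then have "to_fract (\<Sum>k\<in>UNIV. char_mat A $ i $ k * p k j) = to_fract (if i = j then q else 0)"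
      by (simp only: to_fract_sum to_fract_mult)
    then show "(\<Sum>k\<in>UNIV. char_mat A $ i $ k * p k j) = (if i = j then q else 0)"
      by (simp only: to_fract_eq_iff)
  qed simp
  then show ?thesis
    using p q schur_poly_det_char_mat[OF assms]
    unfolding RH_inf_sp_iff ssproper_iff q_def by blast
qed


section \<open>Matrix and block matrix algebra\<close>

lemma matrix_uminus_left: "(- X) ** Y = - (X ** Y)" for X :: "'a::ring_1 ^ 'n ^ 'm"
  by (simp add: matrix_matrix_mult_def vec_eq_iff sum_negf)

lemma matrix_uminus_right: "X ** (- Y) = - (X ** Y)" for X :: "'a::ring_1 ^ 'n ^ 'm"
  by (simp add: matrix_matrix_mult_def vec_eq_iff sum_negf)

lemma matrix_diff_ldistrib: "X ** (Y - Z) = X ** Y - X ** Z" for X :: "'a::ring_1 ^ 'n ^ 'm"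
  by (simp add: matrix_matrix_mult_def vec_eq_iff sum_subtractf right_diff_distrib)

lemma matrix_diff_rdistrib: "(X - Y) ** Z = X ** Z - Y ** Z" for X :: "'a::ring_1 ^ 'n ^ 'm"
  by (simp add: matrix_matrix_mult_def vec_eq_iff sum_subtractf left_diff_distrib)

lemma matrix_add_rdistrib: "(X + Y) ** Z = X ** Z + Y ** Z" for X :: "'a::ring_1 ^ 'n ^ 'm"
  by (simp add: matrix_matrix_mult_def vec_eq_iff sum.distrib distrib_right)

lemmas matrix_ring_simps = matrix_add_ldistrib matrix_add_rdistrib matrix_diff_ldistrib
  matrix_diff_rdistrib matrix_uminus_left matrix_uminus_right matrix_mul_assoc

lemma sum_UNIV_sum_type:
  "(\<Sum>k\<in>UNIV. f k) = (\<Sum>k\<in>UNIV. f (Inl k)) + (\<Sum>k\<in>UNIV. f (Inr k))"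
  for f :: "'a::finite + 'b::finite \<Rightarrow> 'c::comm_monoid_add"
  by (simp add: sum.Plus flip: UNIV_Plus_UNIV)

lemma block4_mult_block4:
  "block4 X11 X12 X21 X22 ** block4 Y11 Y12 Y21 Y22 =
    block4 (X11 ** Y11 + X12 ** Y21) (X11 ** Y12 + X12 ** Y22)
      (X21 ** Y11 + X22 ** Y21) (X21 ** Y12 + X22 ** Y22)"
  by (auto simp: block4_def hblock_def vblock_def matrix_matrix_mult_def vec_eq_iff
      sum_UNIV_sum_type split: sum.split)

lemma hblock_mult_block4:
  "hblock X Y ** block4 Y11 Y12 Y21 Y22 = hblock (X ** Y11 + Y ** Y21) (X ** Y12 + Y ** Y22)"
  by (auto simp: block4_def hblock_def vblock_def matrix_matrix_mult_def vec_eq_iff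
      sum_UNIV_sum_type split: sum.split)

lemma block4_mult_vblock:
  "block4 X11 X12 X21 X22 ** vblock X Y = vblock (X11 ** X + X12 ** Y) (X21 ** X + X22 ** Y)"
  by (auto simp: block4_def hblock_def vblock_def matrix_matrix_mult_def vec_eq_iff
      sum_UNIV_sum_type split: sum.split)

lemma hblock_eq_iff: "hblock X Y = hblock X' Y' \<longleftrightarrow> X = X' \<and> Y = Y'"
  by (auto simp: hblock_def vec_eq_iff split_sum_all)

lemma vblock_eq_iff: "vblock X Y = vblock X' Y' \<longleftrightarrow> X = X' \<and> Y = Y'"
  by (auto simp: vblock_def vec_eq_iff split_sum_all)

lemma block4_eq_iff:
  "block4 X11 X12 X21 X22 = block4 Y11 Y12 Y21 Y22 \<longleftrightarrow>
    X11 = Y11 \<and> X12 = Y12 \<and> X21 = Y21 \<and> X22 = Y22"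
  by (auto simp: block4_def hblock_eq_iff vblock_eq_iff)

lemma mat_1_block4: "mat 1 = block4 (mat 1) 0 0 (mat 1)"
  by (auto simp: block4_def hblock_def vblock_def mat_def vec_eq_iff split: sum.split)


section \<open>System-level and input-output parameters\<close>

text \<open>Since \<open>zI_minus A\<close> is invertible, the block equations can be solved for
  \<open>N\<close> and \<open>M\<close> in terms of \<open>L\<close>, and for \<open>R\<close> in
  terms of \<open>M\<close>. Only the stability conditions remain.\<close>

lemma slp_set_iff:
  "(R, M, N, L) \<in> slp_set A B2 C2 \<longleftrightarrow>
    (R, M, N, L) = slp_of_iop A B2 C2 L \<and>
    R \<in> RH_inf_sp \<and> M \<in> RH_inf_sp \<and> N \<in> RH_inf_sp \<and> L \<in> RH_inf"
proof -
  let ?Z = "zI_minus A" and ?S = "resolvent A" and ?B = "const_tm B2" and ?C = "const_tm C2"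
  note inv = zI_minus_resolvent[of A] resolvent_zI_minus[of A]
  have solve_left: "?Z ** X = Y \<longleftrightarrow> X = ?S ** Y" for X Y :: "ratfun ^ 'd ^ 'a"
    using inv by (metis matrix_mul_assoc matrix_mul_lid)
  have solve_right: "X ** ?Z = Y \<longleftrightarrow> X = Y ** ?S" for X Y :: "ratfun ^ 'a ^ 'd"
    using inv by (metis matrix_mul_assoc matrix_mul_rid)
  have "?Z ** R - ?B ** M = mat 1 \<and> ?Z ** N - ?B ** L = 0 \<and> R ** ?Z - N ** ?C = mat 1 \<and> M ** ?Z - L ** ?C = 0
      \<longleftrightarrow> (R, M, N, L) = slp_of_iop A B2 C2 L" (is "?lhs \<longleftrightarrow> ?rhs")
  proof
    assume eqs: ?lhs
    then have "?Z ** R = mat 1 + ?B ** M" by (simp add: algebra_simps)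
    then have "R = ?S + ?S ** ?B ** M" by (simp add: solve_left matrix_ring_simps)
    moreover have "N = ?S ** ?B ** L" using eqs by (simp add: solve_left matrix_ring_simps)
    moreover have "M = L ** ?C ** ?S" using eqs by (simp add: solve_right matrix_ring_simps)
    ultimately show ?rhs by (simp add: slp_of_iop_def matrix_ring_simps)
  next
    assume ?rhs
    then have eqs: "R = ?S + ?S ** ?B ** L ** ?C ** ?S" "M = L ** ?C ** ?S" "N = ?S ** ?B ** L"
      by (simp_all add: slp_of_iop_def)
    have "?Z ** R = mat 1 + ?B ** M" "R ** ?Z = mat 1 + N ** ?C"
      "?Z ** N = ?B ** L" "M ** ?Z = L ** ?C"
      unfolding solve_left solve_right by (simp_all add: eqs matrix_ring_simps)
    then show ?lhs by simp
  qed
  then show ?thesis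
    by (auto simp: slp_set_def hblock_mult_block4 block4_mult_vblock hblock_eq_iff vblock_eq_iff
        matrix_ring_simps)
qed

text \<open>The identity blocks make the equations explicit. They give \<open>W = P ** Z\<close> as
  well as \<open>W = Y ** P\<close>, and both become \<open>P + P ** U ** P\<close> after inserting
  \<open>Z\<close> and \<open>Y\<close>.\<close>

lemma iop_set_iff:
  "(Y, U, W, Z) \<in> iop_set P \<longleftrightarrow>
    Y = mat 1 + P ** U \<and> Z = mat 1 + U ** P \<and> W = P + P ** U ** P \<and>
    Y \<in> RH_inf \<and> U \<in> RH_inf \<and> W \<in> RH_inf \<and> Z \<in> RH_inf"
  unfolding iop_set_def
  by (auto simp: hblock_mult_block4 block4_mult_vblock hblock_eq_iff vblock_eq_iff
      matrix_ring_simps algebra_simps)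

text \<open>The only quadruple with second component \<open>U\<close> that satisfies the affine
  constraints, so its membership in \<open>iop_set P\<close> says exactly that its four components
  are stable.\<close>

definition iop_param :: "ratfun ^ 'm ^ 'p \<Rightarrow> ratfun ^ 'p ^ 'm \<Rightarrow> ('m, 'p) iop"
  where "iop_param P U = (mat 1 + P ** U, U, P + P ** U ** P, mat 1 + U ** P)"

section \<open>Constant matrices and resolvents under feedback\<close>

lemma to_fract_const_add: "to_fract [:a + b:] = to_fract [:a:] + to_fract [:b:]"
  by (simp flip: to_fract_add)

lemma to_fract_const_mult: "to_fract [:a * b:] = to_fract [:a:] * to_fract [:b:]"
  by (simp flip: to_fract_mult)

lemma const_tm_add: "const_tm (X + Y) = const_tm X + const_tm Y"
  by (simp add: const_tm_def vec_eq_iff to_fract_const_add flip: to_fract_def)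

lemma to_fract_const_sum: "to_fract [:sum f I:] = (\<Sum>i\<in>I. to_fract [:f i:])"
  by (induction I rule: infinite_finite_induct) (auto simp: to_fract_const_add)

lemma const_tm_mult: "const_tm (X ** Y) = const_tm X ** const_tm Y"
  by (simp add: const_tm_def vec_eq_iff matrix_matrix_mult_def to_fract_const_sum
      to_fract_const_mult flip: to_fract_def)

lemma zI_minus_add_mult: "zI_minus (A + B ** F) = zI_minus A - const_tm B ** const_tm F"
  by (simp add: zI_minus_def const_tm_add const_tm_mult)

text \<open>The resolvent identity in both orders, obtained by placing
  \<open>zI_minus A' = zI_minus A - K\<close> between the two resolvents. It is applied with
  \<open>K\<close> coming from a state feedback or from an output injection.\<close>

lemma resolvent_feedback:
  assumes K: "zI_minus A' = zI_minus A - K"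
  shows "resolvent A = resolvent A' - resolvent A ** K ** resolvent A'"
    and "resolvent A = resolvent A' - resolvent A' ** K ** resolvent A"
proof -
  have "resolvent A ** zI_minus A' ** resolvent A' = resolvent A"
    by (simp add: zI_minus_resolvent flip: matrix_mul_assoc)
  then show "resolvent A = resolvent A' - resolvent A ** K ** resolvent A'"
    by (simp add: K matrix_ring_simps resolvent_zI_minus)
  have "resolvent A' ** zI_minus A' ** resolvent A = resolvent A"
    by (simp add: resolvent_zI_minus)
  then show "resolvent A = resolvent A' - resolvent A' ** K ** resolvent A"
    by (simp add: K matrix_ring_simps zI_minus_resolvent flip: matrix_mul_assoc)
qed

lemmas RH_inf_intros = RH_inf_add RH_inf_diff RH_inf_mult RH_inf_mat_1 RH_inf_const

text \<open>The resolvent of \<open>A\<close> may be unstable. In the direction from IOP to SLP it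
  is expanded on the left through \<open>E\<close> or on the right through \<open>G\<close>, so that
  what is left of it is absorbed into \<open>P\<close> and hence into the stable IOP maps.\<close>

lemma slp_of_iop_in_slp_set_iff:
  assumes "stabilizable A B2" "detectable A C2"
  shows "slp_of_iop A B2 C2 U \<in> slp_set A B2 C2 \<longleftrightarrow>
    iop_param (plant22 A B2 C2) U \<in> iop_set (plant22 A B2 C2)"
proof -
  let ?S = "resolvent A" and ?B = "const_tm B2" and ?C = "const_tm C2"
  define P where "P = plant22 A B2 C2"
  have P: "P = ?C ** ?S ** ?B" by (simp add: P_def plant22_def)
  have slp: "slp_of_iop A B2 C2 U \<in> slp_set A B2 C2 \<longleftrightarrow>
      ?S + ?S ** ?B ** U ** ?C ** ?S \<in> RH_inf_sp \<and> U ** ?C ** ?S \<in> RH_inf_sp \<and>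
      ?S ** ?B ** U \<in> RH_inf_sp \<and> U \<in> RH_inf"
    by (simp add: slp_of_iop_def slp_set_iff)
  have iop: "iop_param P U \<in> iop_set P \<longleftrightarrow>
      mat 1 + P ** U \<in> RH_inf \<and> U \<in> RH_inf \<and> P + P ** U ** P \<in> RH_inf \<and> mat 1 + U ** P \<in> RH_inf"
    by (simp add: iop_param_def iop_set_iff)
  have "iop_param P U \<in> iop_set P" if "slp_of_iop A B2 C2 U \<in> slp_set A B2 C2"
  proof -
    have st: "?S + ?S ** ?B ** U ** ?C ** ?S \<in> RH_inf" "U ** ?C ** ?S \<in> RH_inf"
      "?S ** ?B ** U \<in> RH_inf" "U \<in> RH_inf"
      using that by (auto simp: slp intro: RH_inf_sp_imp_RH_inf)
    have "mat 1 + ?C ** (?S ** ?B ** U) \<in> RH_inf" "mat 1 + (U ** ?C ** ?S) ** ?B \<in> RH_inf"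
      "?C ** (?S + ?S ** ?B ** U ** ?C ** ?S) ** ?B \<in> RH_inf"
      using st by (blast intro: RH_inf_intros)+
    then show ?thesis
      using st(4) unfolding iop by (simp add: P matrix_ring_simps)
  qed
  moreover have "slp_of_iop A B2 C2 U \<in> slp_set A B2 C2" if "iop_param P U \<in> iop_set P"
  proof -
    obtain F where F: "schur_stable (A + B2 ** F)"
      using assms(1) by (auto simp: stabilizable_def)
    obtain H where H: "schur_stable (A + H ** C2)"
      using assms(2) by (auto simp: detectable_def)
    let ?F = "const_tm F" and ?H = "const_tm H"
    define G where "G = resolvent (A + B2 ** F)"
    define E where "E = resolvent (A + H ** C2)"
    have G: "G \<in> RH_inf_sp" and E: "E \<in> RH_inf_sp"
      using F H by (simp_all add: G_def E_def resolvent_in_RH_inf_sp)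
    have SG: "?S = G - ?S ** ?B ** ?F ** G"
      unfolding G_def by (rule resolvent_feedback(1)[OF zI_minus_add_mult, unfolded matrix_mul_assoc])
    have SE: "?S = E - E ** ?H ** ?C ** ?S"
      unfolding E_def by (rule resolvent_feedback(2)[OF zI_minus_add_mult, unfolded matrix_mul_assoc])
    have U: "U \<in> RH_inf" and PUP: "P + P ** U ** P \<in> RH_inf" using that by (auto simp: iop)
    \<comment> \<open>These are the IOP components \<open>Y\<close> and \<open>Z\<close> minus the
      identity.\<close>
    have PU: "P ** U \<in> RH_inf" and UP: "U ** P \<in> RH_inf"
      using that RH_inf_diff[OF _ RH_inf_mat_1, of "mat 1 + P ** U"]
        RH_inf_diff[OF _ RH_inf_mat_1, of "mat 1 + U ** P"] by (auto simp: iop)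
    note intros = RH_inf_sp_add RH_inf_sp_diff RH_inf_sp_mult_right RH_inf_sp_mult_left[OF _ G] RH_inf_intros
    \<comment> \<open>Expanding on the left puts \<open>?C\<close> in front of the remaining
      resolvent, which completes it to \<open>P\<close>. The strictly proper factor \<open>E\<close>
      makes the result strictly proper.\<close>
    have "?S ** ?B ** U = (E - E ** ?H ** ?C ** ?S) ** ?B ** U"
      by (simp only: SE[symmetric])
    also have "\<dots> = E ** (?B ** U) - E ** (?H ** (P ** U))"
      by (simp add: P matrix_ring_simps)
    finally have N: "?S ** ?B ** U \<in> RH_inf_sp"
      using U PU E by (simp add: intros)
    have "U ** ?C ** ?S = U ** ?C ** (G - ?S ** ?B ** ?F ** G)"
      by (simp only: SG[symmetric])
    also have "\<dots> = (U ** ?C) ** G - (U ** P ** ?F) ** G"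
      by (simp add: P matrix_ring_simps)
    finally have M: "U ** ?C ** ?S \<in> RH_inf_sp"
      using U UP by (simp add: intros)
    \<comment> \<open>An auxiliary map, \<open>Y ** ?C ** ?S\<close> in IOP terms, which appears
      when \<open>R\<close> is expanded below. Expanding it on the right through \<open>G\<close>
      leaves \<open>W = P + P ** U ** P\<close>.\<close>
    have "?C ** ?S + P ** U ** ?C ** ?S = (?C + P ** U ** ?C) ** ?S"
      by (simp add: matrix_ring_simps)
    also have "\<dots> = (?C + P ** U ** ?C) ** (G - ?S ** ?B ** ?F ** G)"
      by (simp only: SG[symmetric])
    also have "\<dots> = (?C + P ** U ** ?C) ** G - ((P + P ** U ** P) ** ?F) ** G"
      by (simp add: P matrix_ring_simps)
    finally have X: "?C ** ?S + P ** U ** ?C ** ?S \<in> RH_inf_sp"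
      using PU PUP by (simp add: intros)
    \<comment> \<open>In \<open>R\<close> only the left resolvent is expanded; the remaining factors
      are \<open>M\<close> and the auxiliary map, whose stability is already known.\<close>
    have "?S + ?S ** ?B ** U ** ?C ** ?S = ?S ** (mat 1 + ?B ** U ** ?C ** ?S)"
      by (simp add: matrix_ring_simps)
    also have "\<dots> = (E - E ** ?H ** ?C ** ?S) ** (mat 1 + ?B ** U ** ?C ** ?S)"
      by (simp only: SE[symmetric])
    also have "\<dots> = E + E ** (?B ** (U ** ?C ** ?S)) - E ** (?H ** (?C ** ?S + P ** U ** ?C ** ?S))"
      by (simp add: P matrix_ring_simps)
    finally have "?S + ?S ** ?B ** U ** ?C ** ?S \<in> RH_inf_sp"
      using M[THEN RH_inf_sp_imp_RH_inf] X[THEN RH_inf_sp_imp_RH_inf] E by (simp add: intros)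
    with M N U show ?thesis by (simp add: slp)
  qed
  ultimately show ?thesis by (auto simp: P_def)
qed


section \<open>The Youla parameter\<close>

text \<open>For stable \<open>Q\<close> the Bezout identities turn all four IOP maps into products
  of stable factors. Conversely \<open>U\<close> determines \<open>Q\<close> through inverses that
  need not be stable, and the Bezout identities are used again to show that \<open>Q\<close>
  is.\<close>

lemma iop_set_iff_youla:
  assumes "doubly_coprime_factorization P Ul Vl Nl Ml Ur Vr Nr Mr"
  shows "iop_param P U \<in> iop_set P \<longleftrightarrow> (\<exists>Q\<in>RH_inf. U = (Vr - Mr ** Q) ** Ml)"
proof -
  have rh: "Ul \<in> RH_inf" "Vl \<in> RH_inf" "Nl \<in> RH_inf" "Ml \<in> RH_inf"
    "Ur \<in> RH_inf" "Vr \<in> RH_inf" "Nr \<in> RH_inf" "Mr \<in> RH_inf"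
    and P: "P = Nr ** matrix_inv Mr" "P = matrix_inv Ml ** Nl"
    and inv: "invertible Mr" "invertible Ml"
    and blk: "block4 Ul (- Vl) (- Nl) Ml ** block4 Mr Vr Nr Ur = mat 1"
    using assms by (auto simp: doubly_coprime_factorization_def)
  \<comment> \<open>A one-sided inverse of a square matrix is two-sided. The reversed product
    supplies the last four identities of \<open>bez\<close>.\<close>
  have "block4 Mr Vr Nr Ur ** block4 Ul (- Vl) (- Nl) Ml = mat 1"
    using blk matrix_left_right_inverse by blast
  then have bez: "Ul ** Mr = mat 1 + Vl ** Nr" "Ml ** Ur = mat 1 + Nl ** Vr"
    "Mr ** Ul = mat 1 + Vr ** Nl" "Vr ** Ml = Mr ** Vl" "Ur ** Ml = mat 1 + Nr ** Vl"
    "Nr ** Ul = Ur ** Nl"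
    using blk by (auto simp: mat_1_block4 block4_mult_block4 block4_eq_iff matrix_ring_simps algebra_simps)
  have "\<exists>X. Mr ** X = mat 1 \<and> X ** Mr = mat 1" "\<exists>X. Ml ** X = mat 1 \<and> X ** Ml = mat 1"
    using inv unfolding invertible_def .
  from this[THEN someI_ex] have Mi: "Mr ** matrix_inv Mr = mat 1" "matrix_inv Mr ** Mr = mat 1"
    "Ml ** matrix_inv Ml = mat 1" "matrix_inv Ml ** Ml = mat 1"
    by (simp_all add: matrix_inv_def)
  have "P ** Mr = Nr"
    by (metis P(1) Mi(2) matrix_mul_assoc matrix_mul_rid)
  moreover have "Ml ** P = Nl"
    by (metis P(2) Mi(3) matrix_mul_assoc matrix_mul_lid)
  ultimately have PM: "P ** Mr = Nr" "Ml ** P = Nl" .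
  have iop: "iop_param P U \<in> iop_set P \<longleftrightarrow>
      mat 1 + P ** U \<in> RH_inf \<and> U \<in> RH_inf \<and> P + P ** U ** P \<in> RH_inf \<and> mat 1 + U ** P \<in> RH_inf"
    by (simp add: iop_param_def iop_set_iff)
  show ?thesis
  proof
    assume "\<exists>Q\<in>RH_inf. U = (Vr - Mr ** Q) ** Ml"
    then obtain Q where Q: "Q \<in> RH_inf" and U: "U = (Vr - Mr ** Q) ** Ml" by blast
    \<comment> \<open>With \<open>Mr\<close> in front, \<open>P ** U\<close> simplifies by
      \<open>P ** Mr = Nr\<close>; with \<open>Ml\<close> at the end, \<open>U ** P\<close>
      simplifies by \<open>Ml ** P = Nl\<close>.\<close>
    have U': "U = Mr ** (Vl - Q ** Ml)" by (simp add: U matrix_ring_simps bez)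
    have "P ** U = Nr ** (Vl - Q ** Ml)"
      by (simp add: U' PM matrix_mul_assoc)
    then have Y: "mat 1 + P ** U = (Ur - Nr ** Q) ** Ml"
      by (simp add: matrix_ring_simps bez)
    have "U ** P = (Vr - Mr ** Q) ** Nl"
      by (simp add: U PM flip: matrix_mul_assoc)
    then have Z: "mat 1 + U ** P = Mr ** (Ul - Q ** Nl)"
      by (simp add: matrix_ring_simps bez)
    have "P + P ** U ** P = P ** (mat 1 + U ** P)"
      by (simp add: matrix_ring_simps)
    then have W: "P + P ** U ** P = Nr ** (Ul - Q ** Nl)"
      by (simp add: Z PM matrix_mul_assoc)
    show "iop_param P U \<in> iop_set P"
      unfolding iop unfolding Y Z W unfolding U using rh Q by (simp add: RH_inf_intros)
  next
    assume feas: "iop_param P U \<in> iop_set P"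
    \<comment> \<open>The solution of \<open>U = (Vr - Mr ** Q) ** Ml\<close>.\<close>
    define Q where "Q = matrix_inv Mr ** (Vr - U ** matrix_inv Ml)"
    have MrQ: "Mr ** Q = Vr - U ** matrix_inv Ml"
      by (simp add: Q_def Mi matrix_mul_assoc)
    have U: "U = (Vr - Mr ** Q) ** Ml"
      by (simp add: MrQ Mi flip: matrix_mul_assoc)
    \<comment> \<open>In \<open>a\<close> to \<open>d\<close>, each product around \<open>Q\<close>
      is a product of coprime factors minus one of the IOP components \<open>U\<close>,
      \<open>Z\<close>, \<open>Y\<close>, \<open>W\<close>, in this order, and is therefore
      stable.\<close>
    have a: "Mr ** Q ** Ml = Vr ** Ml - U"
      by (simp add: U matrix_ring_simps)
    have "Mr ** Q ** Nl = Mr ** Q ** Ml ** P"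
      by (simp add: PM flip: matrix_mul_assoc)
    also have "\<dots> = Vr ** Nl - U ** P"
      unfolding a by (simp add: matrix_diff_rdistrib PM flip: matrix_mul_assoc)
    finally have b: "Mr ** Q ** Nl = Mr ** Ul - (mat 1 + U ** P)"
      by (simp add: bez)
    have "Nr ** Q ** Ml = P ** (Mr ** Q ** Ml)"
      by (simp add: PM matrix_mul_assoc)
    then have c: "Nr ** Q ** Ml = Ur ** Ml - (mat 1 + P ** U)"
      by (simp add: a bez matrix_ring_simps PM)
    have "Nr ** Q ** Nl = P ** (Mr ** Q ** Nl)"
      by (simp add: PM matrix_mul_assoc)
    then have d: "Nr ** Q ** Nl = Nr ** Ul - (P + P ** U ** P)"
      by (simp add: b matrix_ring_simps PM)
    \<comment> \<open>Both brackets are the identity; multiplying out leaves \<open>Q\<close> only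
      inside the four stable products.\<close>
    have "Q = (Ul ** Mr - Vl ** Nr) ** Q ** (Ml ** Ur - Nl ** Vr)"
      by (simp add: bez)
    also have "\<dots> = Ul ** (Mr ** Q ** Ml) ** Ur - Ul ** (Mr ** Q ** Nl) ** Vr
        - Vl ** (Nr ** Q ** Ml) ** Ur + Vl ** (Nr ** Q ** Nl) ** Vr"
      by (simp add: matrix_ring_simps)
    also have "\<dots> \<in> RH_inf"
      unfolding a b c d using rh feas by (simp add: iop RH_inf_intros)
    finally show "\<exists>Q\<in>RH_inf. U = (Vr - Mr ** Q) ** Ml"
      using U by blast
  qed
qed

lemma slp_of_youla_eq: "slp_of_youla A B2 C2 Vr Mr Ml Q = slp_of_iop A B2 C2 ((Vr - Mr ** Q) ** Ml)"
  by (simp add: slp_of_youla_def slp_of_iop_def matrix_mul_assoc)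


section \<open>Feasible sets\<close>

lemma slp_set_eq:
  assumes "stabilizable A B2" "detectable A C2"
  shows "slp_set A B2 C2 = {slp_of_iop A B2 C2 U |U. iop_param (plant22 A B2 C2) U \<in> iop_set (plant22 A B2 C2)}"
proof -
  have "\<exists>U. X = slp_of_iop A B2 C2 U" if "X \<in> slp_set A B2 C2" for X
    using that by (cases X) (metis slp_set_iff)
  then show ?thesis
    using slp_of_iop_in_slp_set_iff[OF assms] by blast
qed

lemma sls_feasible_eq:
  assumes "stabilizable A B2" "detectable A C2"
  shows "sls_feasible A B2 C2 S = {slp_of_iop A B2 C2 U |U.
    iop_param (plant22 A B2 C2) U \<in> iop_set (plant22 A B2 C2) \<and> slp_block (slp_of_iop A B2 C2 U) \<in> S}"
  by (auto simp: sls_feasible_def slp_set_eq[OF assms])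

lemma slp_of_youla_image:
  assumes "stabilizable A B2" "detectable A C2"
    and "doubly_coprime_factorization (plant22 A B2 C2) Ul Vl Nl Ml Ur Vr Nr Mr"
  shows "slp_of_youla A B2 C2 Vr Mr Ml ` youla_feasible A B2 C2 Vr Mr Ml S = sls_feasible A B2 C2 S"
  unfolding sls_feasible_eq[OF assms(1,2)] iop_set_iff_youla[OF assms(3)]
  by (auto simp: youla_feasible_def slp_of_youla_eq)

lemma slp_of_iop_image:
  assumes "stabilizable A B2" "detectable A C2"
  shows "(\<lambda>(Y, U, W, Z). slp_of_iop A B2 C2 U) ` iop_feasible A B2 C2 S = sls_feasible A B2 C2 S"
proof -
  have "iop_feasible A B2 C2 S = iop_param (plant22 A B2 C2) ` {U.
    iop_param (plant22 A B2 C2) U \<in> iop_set (plant22 A B2 C2) \<and> slp_block (slp_of_iop A B2 C2 U) \<in> S}"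
    by (auto simp: iop_feasible_def iop_set_iff iop_param_def)
  then show ?thesis
    unfolding sls_feasible_eq[OF assms] by (auto simp: iop_param_def image_image)
qed

text \<open>When the objective is pulled back along a surjection onto \<open>F2\<close>, equality of
  the optimal values is a reindexing of the infimum.\<close>

lemma equivalent_underI:
  assumes "\<phi> ` F1 = F2"
  shows "equivalent_under \<phi> F1 (\<lambda>x. J (\<phi> x)) F2 J"
  unfolding equivalent_under_def assms[symmetric] by (simp add: image_image)


section \<open>Convexity\<close>

text \<open>Preservation of affine combinations is closed under sums, pairing, composition and
  multiplication by a fixed matrix without splitting off a linear part; convex combinations are a
  special case.\<close>

definition affine_map :: "('a::real_vector \<Rightarrow> 'b::real_vector) \<Rightarrow> bool"
  where "affine_map f \<longleftrightarrow>
    (\<forall>x y u v. u + v = 1 \<longrightarrow> f (u *\<^sub>R x + v *\<^sub>R y) = u *\<^sub>R f x + v *\<^sub>R f y)"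

lemma affine_mapD:
  "affine_map f \<Longrightarrow> u + v = 1 \<Longrightarrow> f (u *\<^sub>R x + v *\<^sub>R y) = u *\<^sub>R f x + v *\<^sub>R f y"
  by (simp add: affine_map_def)

lemma affine_map_const: "affine_map (\<lambda>x. c)"
  by (simp add: affine_map_def flip: scaleR_add_left)

lemma affine_map_id: "affine_map (\<lambda>x. x)"
  by (simp add: affine_map_def)

lemma affine_map_add: "affine_map f \<Longrightarrow> affine_map g \<Longrightarrow> affine_map (\<lambda>x. f x + g x)"
  by (simp add: affine_map_def algebra_simps)

lemma affine_map_diff: "affine_map f \<Longrightarrow> affine_map g \<Longrightarrow> affine_map (\<lambda>x. f x - g x)"
  by (simp add: affine_map_def algebra_simps)

lemma affine_map_Pair: "affine_map f \<Longrightarrow> affine_map g \<Longrightarrow> affine_map (\<lambda>x. (f x, g x))"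
  by (simp add: affine_map_def)

lemma affine_map_compose: "affine_map f \<Longrightarrow> affine_map g \<Longrightarrow> affine_map (\<lambda>x. f (g x))"
  by (simp add: affine_map_def)

lemma convex_affine_vimage: "affine_map f \<Longrightarrow> convex S \<Longrightarrow> convex {x. f x \<in> S}"
  by (simp add: convex_def affine_mapD)

lemma convex_affine_eq: "affine_map f \<Longrightarrow> affine_map g \<Longrightarrow> convex {x. f x = g x}"
  by (simp add: convex_def affine_mapD)

lemma convex_on_affine_vimage:
  "affine_map f \<Longrightarrow> convex_on D J \<Longrightarrow> convex_on {x. f x \<in> D} (\<lambda>x. J (f x))"
  by (simp add: convex_on_def affine_mapD convex_affine_vimage)

lemma convex_problem_affine:
  assumes "affine_map f" "convex_on D J" "convex F" "f ` F \<subseteq> D"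
  shows "convex_problem {x. f x \<in> D} F (\<lambda>x. J (f x))"
  using assms by (auto simp: convex_problem_def convex_on_affine_vimage)

lemma scaleR_fract_mult_left: "(r *\<^sub>R x) * y = r *\<^sub>R (x * y)"
  and scaleR_fract_mult_right: "x * (r *\<^sub>R y) = r *\<^sub>R (x * y)" for x y :: ratfun
  by (simp_all add: scaleR_fract_def mult_ac)

lemma scaleR_matrix_mult_left: "(r *\<^sub>R X) ** Y = r *\<^sub>R (X ** Y)"
  and scaleR_matrix_mult_right: "X ** (r *\<^sub>R Y) = r *\<^sub>R (X ** Y)" for X :: "ratfun ^ 'n ^ 'm"
  by (simp_all add: matrix_matrix_mult_def vec_eq_iff scaleR_fract_mult_left
      scaleR_fract_mult_right scaleR_sum_right)

lemma affine_map_mult_left: "affine_map f \<Longrightarrow> affine_map (\<lambda>x. f x ** Y)" for Y :: "ratfun ^ 'n ^ 'm"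
  by (simp add: affine_map_def matrix_ring_simps scaleR_matrix_mult_left)

lemma affine_map_mult_right: "affine_map f \<Longrightarrow> affine_map (\<lambda>x. Y ** f x)" for Y :: "ratfun ^ 'n ^ 'm"
  by (simp add: affine_map_def matrix_ring_simps scaleR_matrix_mult_right)

lemmas affine_map_intros = affine_map_const affine_map_id affine_map_add affine_map_diff
  affine_map_Pair affine_map_mult_left affine_map_mult_right

lemma affine_map_slp_of_iop: "affine_map (slp_of_iop A B2 C2)"
  unfolding slp_of_iop_def by (intro affine_map_intros)

lemma affine_map_slp_of_youla: "affine_map (slp_of_youla A B2 C2 Vr Mr Ml)"
  unfolding slp_of_youla_def by (intro affine_map_intros)

lemma affine_map_slp_block: "affine_map slp_block"
  by (auto simp: affine_map_def slp_block_def block4_def hblock_def vblock_def vec_eq_iff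
      split: sum.split)

section \<open>Convexity of the feasible sets\<close>

lemma convex_RH_inf: "convex RH_inf"
  by (simp add: convex_def RH_inf_add RH_inf_scaleR)

lemma convex_iop_set: "convex (iop_set P)" for P :: "ratfun ^ 'm ^ 'p"
proof -
  let ?Y = "\<lambda>X::('m, 'p) iop. fst X" and ?U = "\<lambda>X::('m, 'p) iop. fst (snd X)"
    and ?W = "\<lambda>X::('m, 'p) iop. fst (snd (snd X))" and ?Z = "\<lambda>X::('m, 'p) iop. snd (snd (snd X))"
  have aff: "affine_map ?Y" "affine_map ?U" "affine_map ?W" "affine_map ?Z"
    by (simp_all add: affine_map_def)
  \<comment> \<open>Each piece is the solution set of an affine equation or the preimage of the
    convex set \<open>RH_inf\<close> under a projection.\<close>
  have "iop_set P = {X. ?Y X = mat 1 + P ** ?U X} \<inter> {X. ?Z X = mat 1 + ?U X ** P} \<inter>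
      {X. ?W X = P + P ** ?U X ** P} \<inter> {X. ?Y X \<in> RH_inf} \<inter> {X. ?U X \<in> RH_inf} \<inter>
      {X. ?W X \<in> RH_inf} \<inter> {X. ?Z X \<in> RH_inf}"
    by (auto simp: iop_set_iff)
  also have "convex \<dots>"
    by (intro convex_Int convex_affine_eq convex_affine_vimage convex_RH_inf affine_map_intros aff)
  finally show ?thesis .
qed

lemma convex_youla_feasible:
  assumes "convex S"
  shows "convex (youla_feasible A B2 C2 Vr Mr Ml S)"
proof -
  have "youla_feasible A B2 C2 Vr Mr Ml S =
      RH_inf \<inter> {Q. slp_block (slp_of_youla A B2 C2 Vr Mr Ml Q) \<in> S}"
    by (auto simp: youla_feasible_def)
  also have "convex \<dots>"
    by (intro convex_Int convex_RH_inf convex_affine_vimage[OF _ assms]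
        affine_map_compose[OF affine_map_slp_block affine_map_slp_of_youla])
  finally show ?thesis .
qed

lemma affine_map_slp_of_iop_tuple: "affine_map (\<lambda>(Y, U, W, Z). slp_of_iop A B2 C2 U)"
proof -
  have "affine_map (\<lambda>X. slp_of_iop A B2 C2 (fst (snd X)))"
    by (intro affine_map_compose[OF affine_map_slp_of_iop])
      (simp add: affine_map_def)
  then show ?thesis by (simp add: case_prod_unfold)
qed

lemma convex_iop_feasible:
  assumes "convex S"
  shows "convex (iop_feasible A B2 C2 S)"
proof -
  have "iop_feasible A B2 C2 S =
      iop_set (plant22 A B2 C2) \<inter> {X. slp_block ((\<lambda>(Y, U, W, Z). slp_of_iop A B2 C2 U) X) \<in> S}"
    by (auto simp: iop_feasible_def)
  also have "convex \<dots>"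
    by (intro convex_Int convex_iop_set convex_affine_vimage[OF _ assms]
        affine_map_compose[OF affine_map_slp_block affine_map_slp_of_iop_tuple])
  finally show ?thesis .
qed

text \<open>The convexity claim ranges over every domain \<open>D\<close> that contains the SLS
  feasible set and on which \<open>g\<close> is convex; \<open>D = UNIV\<close> covers functionals
  that are convex everywhere. The domains of the other two problems are the preimages of
  \<open>D\<close> under the substitutions.\<close>

theorem theorem4:
  fixes A :: "real ^ 'n ^ 'n" and B2 :: "real ^ 'm ^ 'n" and C2 :: "real ^ 'n ^ 'p"
    and Ul :: "ratfun ^ 'm ^ 'm" and Vl :: "ratfun ^ 'p ^ 'm"
    and Nl :: "ratfun ^ 'm ^ 'p" and Ml :: "ratfun ^ 'p ^ 'p"
    and Ur :: "ratfun ^ 'p ^ 'p" and Vr :: "ratfun ^ 'p ^ 'm"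
    and Nr :: "ratfun ^ 'm ^ 'p" and Mr :: "ratfun ^ 'm ^ 'm"
    and g :: "('n, 'm, 'p) slp \<Rightarrow> real"
    and S :: "(ratfun ^ ('n + 'p) ^ ('n + 'm)) set"
  assumes stab: "stabilizable A B2"
    and det: "detectable A C2"
    and dcf: "doubly_coprime_factorization (plant22 A B2 C2) Ul Vl Nl Ml Ur Vr Nr Mr"
  shows
    "equivalent_under (slp_of_youla A B2 C2 Vr Mr Ml)
       (youla_feasible A B2 C2 Vr Mr Ml S) (\<lambda>Q. g (slp_of_youla A B2 C2 Vr Mr Ml Q))
       (sls_feasible A B2 C2 S) g
     \<and> equivalent_under (\<lambda>(Y, U, W, Z). slp_of_iop A B2 C2 U)
       (iop_feasible A B2 C2 S) (\<lambda>(Y, U, W, Z). g (slp_of_iop A B2 C2 U))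
       (sls_feasible A B2 C2 S) g
     \<and> (\<forall>D. sls_feasible A B2 C2 S \<subseteq> D \<longrightarrow> convex_on D g \<longrightarrow> convex S \<longrightarrow>
         convex_problem {Q. slp_of_youla A B2 C2 Vr Mr Ml Q \<in> D}
           (youla_feasible A B2 C2 Vr Mr Ml S) (\<lambda>Q. g (slp_of_youla A B2 C2 Vr Mr Ml Q))
         \<and> convex_problem {(Y, U, W, Z). slp_of_iop A B2 C2 U \<in> D}
           (iop_feasible A B2 C2 S) (\<lambda>(Y, U, W, Z). g (slp_of_iop A B2 C2 U)))"
proof (intro conjI allI impI)
  let ?\<phi> = "\<lambda>(Y, U, W, Z). slp_of_iop A B2 C2 U"
  note youla = slp_of_youla_image[OF stab det dcf, of S]
  note iop = slp_of_iop_image[OF stab det, of S]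
  \<comment> \<open>Exhibits the objective as a composition with the substitution, the form required
    by \<open>equivalent_underI\<close> and \<open>convex_problem_affine\<close>.\<close>
  have g: "(\<lambda>(Y, U, W, Z). g (slp_of_iop A B2 C2 U)) = (\<lambda>X. g (?\<phi> X))"
    by (auto simp: fun_eq_iff)
  show "equivalent_under (slp_of_youla A B2 C2 Vr Mr Ml)
       (youla_feasible A B2 C2 Vr Mr Ml S) (\<lambda>Q. g (slp_of_youla A B2 C2 Vr Mr Ml Q))
       (sls_feasible A B2 C2 S) g"
    using youla by (rule equivalent_underI)
  show "equivalent_under ?\<phi> (iop_feasible A B2 C2 S) (\<lambda>(Y, U, W, Z). g (slp_of_iop A B2 C2 U))
       (sls_feasible A B2 C2 S) g"
    unfolding g using iop by (rule equivalent_underI)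
  fix D
  assume D: "sls_feasible A B2 C2 S \<subseteq> D" "convex_on D g" "convex S"
  show "convex_problem {Q. slp_of_youla A B2 C2 Vr Mr Ml Q \<in> D}
      (youla_feasible A B2 C2 Vr Mr Ml S) (\<lambda>Q. g (slp_of_youla A B2 C2 Vr Mr Ml Q))"
    using affine_map_slp_of_youla D(2) convex_youla_feasible[OF D(3)]
    by (rule convex_problem_affine) (simp add: youla D(1))
  have "convex_problem {X. ?\<phi> X \<in> D} (iop_feasible A B2 C2 S) (\<lambda>X. g (?\<phi> X))"
    using affine_map_slp_of_iop_tuple D(2) convex_iop_feasible[OF D(3)]
    by (rule convex_problem_affine) (simp add: iop D(1))
  moreover have D': "{(Y, U, W, Z). slp_of_iop A B2 C2 U \<in> D} = {X. ?\<phi> X \<in> D}"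
    by auto
  ultimately show "convex_problem {(Y, U, W, Z). slp_of_iop A B2 C2 U \<in> D}
      (iop_feasible A B2 C2 S) (\<lambda>(Y, U, W, Z). g (slp_of_iop A B2 C2 U))"
    unfolding D' g by blast
qed

end
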